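(* Let $d\ge1$ be an integer, let $\alpha$ be a concave modulus, and let \[\rho\colon \mathbb Z^d\to \mathrm{Diff}_+^{1,\alpha}(S^1)\] be an exceptional action. Suppose that $\rho$ is semi-conjugate to a faithful action \[\bar\rho\colon\mathbb Z^d\to\mathrm{Diff}_+^1(S^1)\] by a semi-conjugacy map $H$ (so $H\circ\rho(g)=\bar\rho(g)\circ H$ for all $g\in\mathbb Z^d$), where $\bar\rho$ is $C^1$-conjugate into the rotation group $\mathrm{SO}(2,\mathbb R)$. Assume that for each generator $s$ of $\mathbb Z^d$ and each $x$ in the exceptional minimal set of $\rho$ we have \[\rho(s)'(x)=\bar\rho(s)'(H(x)).\] Then \[\int_0^1 \frac{\alpha^{-1}(t)}{t^{d+1}}\,dt<\infty.\]
   Context: $S^1=\mathbb R/\mathbb Z$, and $|x-y|$ for $x,y\in S^1$ is the distance modulo $1$. A concave modulus is a homeomorphism $\alpha\colon[0,\infty)\to[0,\infty)$ that is concave; $\alpha^{-1}$ is its inverse function. A function $g\colon S^1\to\mathbb R$ is $\alpha$-continuous if $\sup_{x\neq y}|g(x)-g(y)|/\alpha(|x-y|)<\infty$. $\mathrm{Diff}_+^{1}(S^1)$ is the group of orientation-preserving $C^1$ diffeomorphisms of $S^1$, and $\mathrm{Diff}_+^{1,\alpha}(S^1)$ is the subgroup of those with $\alpha$-continuous derivative. An action is exceptional if it admits an exceptional minimal set, i.e. a minimal nonempty closed invariant set homeomorphic to a Cantor set (this set is then unique). A semi-conjugacy map is a monotone, surjective (hence continuous), degree-one map $S^1\to S^1$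 intertwining the two actions. "$\bar\rho$ is $C^1$-conjugate into $\mathrm{SO}(2,\mathbb R)$" means that there is $h\in\mathrm{Diff}_+^1(S^1)$ such that $h\bar\rho(g)h^{-1}$ is a rotation for every $g$. "Generator" refers to the elements of a fixed finite generating set of $\mathbb Z^d$. *)

theory Defs
  imports "HOL-Analysis.Analysis" "HOL-Computational_Algebra.Group_Closure"
begin

section \<open>The circle as \<open>\<real>/\<int>\<close> with the distance modulo 1\<close>

quotient_type circle = real / "\<lambda>x y :: real. x - y \<in> \<int>"
  morphisms rep_circle circle_of
proof (rule equivpI)
  show "reflp (\<lambda>x y :: real. x - y \<in> \<int>)"
    by (rule reflpI) simp
  show "symp (\<lambda>x y :: real. x - y \<in> \<int>)"
    by (rule sympI) (metis Ints_minus minus_diff_eq)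
  show "transp (\<lambda>x y :: real. x - y \<in> \<int>)"
  proof (rule transpI)
    fix x y z :: real
    assume "x - y \<in> \<int>" "y - z \<in> \<int>"
    then have "(x - y) + (y - z) \<in> \<int>" by (rule Ints_add)
    then show "x - z \<in> \<int>" by simp
  qed
qed

lemma circle_of_eq_iff: "circle_of x = circle_of y \<longleftrightarrow> x - y \<in> \<int>"
  by (rule circle.abs_eq_iff)

lemma circle_of_surj: "\<exists>t. x = circle_of t"
  by (metis Quotient3_abs_rep Quotient3_circle)

lemma round_dist_add_Ints:
  fixes z k :: real
  assumes "k \<in> \<int>"
  shows "\<bar>(z + k) - of_int (round (z + k))\<bar> = \<bar>z - of_int (round z)\<bar>"
proof -
  obtain n :: int where n: "k = of_int n" using assms by (auto elim: Ints_cases)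
  have "\<bar>(z + k) - of_int (round (z + k))\<bar> \<le> \<bar>(z + k) - of_int (round z + n)\<bar>"
    by (rule round_diff_minimal)
  moreover have "\<bar>z - of_int (round z)\<bar> \<le> \<bar>z - of_int (round (z + k) - n)\<bar>"
    by (rule round_diff_minimal)
  ultimately show ?thesis by (simp add: n algebra_simps)
qed

instantiation circle :: metric_space
begin

(* the distance from s - t to the nearest integer *)
lift_definition dist_circle :: "circle \<Rightarrow> circle \<Rightarrow> real"
  is "\<lambda>s t. \<bar>(s - t) - of_int (round (s - t))\<bar>"
proof -
  fix s s' t t' :: real
  assume "s - s' \<in> \<int>" "t - t' \<in> \<int>"
  then have "(s - s') - (t - t') \<in> \<int>" by (rule Ints_diff)
  then have "\<bar>((s' - t') + ((s - s') - (t - t'))) -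
      of_int (round ((s' - t') + ((s - s') - (t - t'))))\<bar> =
      \<bar>(s' - t') - of_int (round (s' - t'))\<bar>"
    by (rule round_dist_add_Ints)
  then show "\<bar>s - t - of_int (round (s - t))\<bar> = \<bar>s' - t' - of_int (round (s' - t'))\<bar>"
    by (simp add: algebra_simps)
qed

definition uniformity_circle :: "(circle \<times> circle) filter"
  where "uniformity_circle = (INF e\<in>{0<..}. principal {(x, y). dist x y < e})"

definition open_circle :: "circle set \<Rightarrow> bool"
  where "open_circle U = (\<forall>x\<in>U. eventually (\<lambda>(x', y). x' = x \<longrightarrow> y \<in> U) uniformity)"

instance
proof
  fix x y z :: circle
  show "dist x y = 0 \<longleftrightarrow> x = y"
  proof (transfer, safe)
    fix s t :: real
    assume "\<bar>s - t - of_int (round (s - t))\<bar> = 0"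
    then have "s - t = of_int (round (s - t))" by simp
    then show "s - t \<in> \<int>" by (metis Ints_of_int)
  next
    fix s t :: real
    assume "s - t \<in> \<int>"
    then obtain n where "s - t = of_int n" by (auto elim: Ints_cases)
    then show "\<bar>s - t - of_int (round (s - t))\<bar> = 0" by simp
  qed
  show "dist x y \<le> dist x z + dist y z"
  proof transfer
    fix x y z :: real
    have "\<bar>x - y - of_int (round (x - y))\<bar>
        \<le> \<bar>x - y - of_int (round (x - z) - round (y - z))\<bar>"
      by (rule round_diff_minimal)
    also have "\<dots> \<le> \<bar>x - z - of_int (round (x - z))\<bar> + \<bar>y - z - of_int (round (y - z))\<bar>"
      by simp
    finally show "\<bar>x - y - of_int (round (x - y))\<bar> \<le>
        \<bar>x - z - of_int (round (x - z))\<bar> + \<bar>y - z - of_int (round (y - z))\<bar>" .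
  qed
qed (simp_all add: uniformity_circle_def open_circle_def)

end

section \<open>Circle maps, lifts and derivatives\<close>

definition is_lift :: "(real \<Rightarrow> real) \<Rightarrow> (circle \<Rightarrow> circle) \<Rightarrow> bool"
  where "is_lift F f \<longleftrightarrow> (\<forall>t. f (circle_of t) = circle_of (F t))"

definition has_circle_derivative :: "(circle \<Rightarrow> circle) \<Rightarrow> real \<Rightarrow> circle \<Rightarrow> bool"
  where "has_circle_derivative f D x \<longleftrightarrow>
    (\<exists>F t. is_lift F f \<and> continuous_on UNIV F \<and> x = circle_of t \<and> (F has_real_derivative D) (at t))"

definition circle_deriv :: "(circle \<Rightarrow> circle) \<Rightarrow> circle \<Rightarrow> real"
  where "circle_deriv f x = (THE D. has_circle_derivative f D x)"

lemma continuous_lifts_differ_by_constant: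
  assumes "is_lift F f" "continuous_on UNIV F" "is_lift G f" "continuous_on UNIV G"
  shows "\<exists>c. \<forall>t. F t = G t + c"
proof -
  have int: "F t - G t \<in> \<int>" for t
    using assms(1,3) unfolding is_lift_def by (metis circle_of_eq_iff)
  have "(\<lambda>t. F t - G t) constant_on UNIV"
  proof (rule continuous_discrete_range_constant)
    show "continuous_on UNIV (\<lambda>t. F t - G t)"
      using assms(2,4) by (intro continuous_intros)
    fix x :: real
    have "1 \<le> norm ((F y - G y) - (F x - G x))" if "F y - G y \<noteq> F x - G x" for y
    proof -
      have "(F y - G y) - (F x - G x) \<in> \<int>" using int[of y] int[of x] by (rule Ints_diff)
      then show ?thesis using that by (simp add: Ints_nonzero_abs_ge1)
    qed
    then show "\<exists>e>0. \<forall>y. y \<in> UNIV \<and> F y - G y \<noteq> F x - G x \<longrightarrow>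
        e \<le> norm ((F y - G y) - (F x - G x))"
      by (intro exI[of _ 1]) auto
  qed simp
  then obtain c where "\<And>t. F t - G t = c" by (auto simp: constant_on_def)
  then have "\<forall>t. F t = G t + c" by (metis diff_add_cancel add.commute)
  then show ?thesis ..
qed

lemma has_circle_derivative_unique:
  assumes "has_circle_derivative f D x" "has_circle_derivative f E x"
  shows "D = E"
proof -
  obtain F s where F: "is_lift F f" "continuous_on UNIV F" "x = circle_of s"
      "(F has_real_derivative D) (at s)"
    using assms(1) unfolding has_circle_derivative_def by blast
  obtain G t where G: "is_lift G f" "continuous_on UNIV G" "x = circle_of t"
      "(G has_real_derivative E) (at t)"
    using assms(2) unfolding has_circle_derivative_def by blast
  define k where "k = t - s"
  have k: "k \<in> \<int>" using F(3) G(3) circle_of_eq_iff k_def by metis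
  let ?G = "\<lambda>u. G (u + k)"
  have "is_lift ?G f"
    unfolding is_lift_def
  proof
    fix u
    have "circle_of u = circle_of (u + k)" using k by (simp add: circle_of_eq_iff)
    then show "f (circle_of u) = circle_of (G (u + k))"
      using G(1) by (simp add: is_lift_def)
  qed
  moreover have "continuous_on UNIV ?G"
    by (rule continuous_on_compose2[OF G(2)]) (auto intro!: continuous_intros)
  ultimately obtain c where c: "\<And>u. F u = ?G u + c"
    using continuous_lifts_differ_by_constant[OF F(1,2)] by blast
  have "(G has_real_derivative E) (at (s + k))" using G(4) by (simp add: k_def)
  then have "(?G has_real_derivative E) (at s)" by (simp add: DERIV_shift)
  then have "((\<lambda>u. ?G u + c) has_real_derivative E) (at s)"
    by (auto intro!: derivative_eq_intros)
  then have "(F has_real_derivative E) (at s)" using c by presburger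
  then show ?thesis using F(4) DERIV_unique by blast
qed

lemma circle_deriv_eq: "has_circle_derivative f D x \<Longrightarrow> circle_deriv f x = D"
  unfolding circle_deriv_def using has_circle_derivative_unique by blast

definition C1_circle_map :: "(circle \<Rightarrow> circle) \<Rightarrow> bool"
  where "C1_circle_map f \<longleftrightarrow>
    (\<forall>x. \<exists>D. has_circle_derivative f D x) \<and> continuous_on UNIV (circle_deriv f)"

definition orientation_preserving :: "(circle \<Rightarrow> circle) \<Rightarrow> bool"
  where "orientation_preserving f \<longleftrightarrow> (\<exists>F. is_lift F f \<and> continuous_on UNIV F \<and> strict_mono F)"

definition Diff1 :: "(circle \<Rightarrow> circle) set"
  where "Diff1 = {f. bij f \<and> C1_circle_map f \<and> C1_circle_map (inv f) \<and> orientation_preserving f}"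

definition concave_modulus :: "(real \<Rightarrow> real) \<Rightarrow> bool"
  where "concave_modulus \<alpha> \<longleftrightarrow>
    (\<exists>\<beta>. homeomorphism {0..} {0..} \<alpha> \<beta>) \<and> concave_on {0..} \<alpha>"

definition modulus_continuous :: "(real \<Rightarrow> real) \<Rightarrow> (circle \<Rightarrow> real) \<Rightarrow> bool"
  where "modulus_continuous \<alpha> g \<longleftrightarrow>
    bdd_above {\<bar>g x - g y\<bar> / \<alpha> (dist x y) | x y. x \<noteq> y}"

definition Diff1_modulus :: "(real \<Rightarrow> real) \<Rightarrow> (circle \<Rightarrow> circle) set"
  where "Diff1_modulus \<alpha> = {f \<in> Diff1. modulus_continuous \<alpha> (circle_deriv f)}"

definition rotation :: "real \<Rightarrow> circle \<Rightarrow> circle"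
  where "rotation a x = circle_of (rep_circle x + a)"

lemma rotation_circle_of: "rotation a (circle_of t) = circle_of (t + a)"
proof -
  have "rep_circle (circle_of t) - t \<in> \<int>"
    by (metis Quotient3_abs_rep Quotient3_circle circle_of_eq_iff)
  then show ?thesis by (simp add: rotation_def circle_of_eq_iff)
qed

section \<open>Actions on the circle\<close>

definition action_in :: "(circle \<Rightarrow> circle) set \<Rightarrow> ('g::group_add \<Rightarrow> circle \<Rightarrow> circle) \<Rightarrow> bool"
  where "action_in G \<rho> \<longleftrightarrow>
    (\<forall>g. \<rho> g \<in> G) \<and> \<rho> 0 = id \<and> (\<forall>g h. \<rho> (g + h) = \<rho> g \<circ> \<rho> h)"

definition invariant_set :: "('g \<Rightarrow> circle \<Rightarrow> circle) \<Rightarrow> circle set \<Rightarrow> bool"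
  where "invariant_set \<rho> K \<longleftrightarrow> (\<forall>g. \<rho> g ` K = K)"

definition minimal_set :: "('g \<Rightarrow> circle \<Rightarrow> circle) \<Rightarrow> circle set \<Rightarrow> bool"
  where "minimal_set \<rho> K \<longleftrightarrow>
    K \<noteq> {} \<and> closed K \<and> invariant_set \<rho> K \<and>
    (\<forall>L. L \<noteq> {} \<and> closed L \<and> invariant_set \<rho> L \<and> L \<subseteq> K \<longrightarrow> L = K)"

(* The Cantor set is represented by its model {0,1}^N: the product topology on nat => bool,
   with bool discrete. *)
definition exceptional_minimal_set :: "('g \<Rightarrow> circle \<Rightarrow> circle) \<Rightarrow> circle set \<Rightarrow> bool"
  where "exceptional_minimal_set \<rho> K \<longleftrightarrow>
    minimal_set \<rho> K \<and> K homeomorphic (UNIV :: (nat \<Rightarrow> bool) set)"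

(* Continuity of the lift is not demanded: it follows from surjectivity. *)
definition monotone_degree_one :: "(circle \<Rightarrow> circle) \<Rightarrow> bool"
  where "monotone_degree_one H \<longleftrightarrow>
    (\<exists>F. is_lift F H \<and> mono F \<and> (\<forall>t. F (t + 1) = F t + 1))"

definition semi_conjugacy ::
    "(circle \<Rightarrow> circle) \<Rightarrow> ('g \<Rightarrow> circle \<Rightarrow> circle) \<Rightarrow> ('g \<Rightarrow> circle \<Rightarrow> circle) \<Rightarrow> bool"
  where "semi_conjugacy H \<rho> \<sigma> \<longleftrightarrow>
    monotone_degree_one H \<and> surj H \<and> (\<forall>g. H \<circ> \<rho> g = \<sigma> g \<circ> H)"

definition C1_conjugate_into_rotations :: "('g \<Rightarrow> circle \<Rightarrow> circle) \<Rightarrow> bool"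
  where "C1_conjugate_into_rotations \<sigma> \<longleftrightarrow>
    (\<exists>h\<in>Diff1. \<forall>g. \<exists>a. h \<circ> \<sigma> g \<circ> inv h = rotation a)"

end

theory Submission
  imports Defs
begin

text \<open>
  The semi-conjugacy \<open>H\<close> collapses an arc \<open>J\<close> of length less than 1 that contains a point \<open>x\<close> of the
  minimal set, because \<open>H\<close> maps the minimal set onto the circle. As \<open>\<rho>bar\<close> is free, the arcs
  \<open>\<rho> g J\<close> are pairwise disjoint, so their lengths have a finite sum. If \<open>h\<close> conjugates \<open>\<rho>bar\<close> to
  rotations, the derivative of \<open>\<rho> g\<close> along the orbit of \<open>x\<close> is a coboundary of \<open>h'\<close>. Hence the
  weighted lengths \<open>L g = h' (H (\<rho> g x)) |\<rho> g J|\<close> change under a generator by a factor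
  \<open>1 + O(\<alpha> (O (L g)))\<close> only: starting from \<open>L 0\<close> it takes of the order of \<open>1 / \<alpha> \<delta>\<close> steps to fall
  below \<open>\<delta>\<close>, and so \<open>L g \<ge> c \<alpha>\<^sup>-\<^sup>1 (c / n)\<close> whenever \<open>|g| \<le> n\<close>. Summing over the
  \<open>2\<^bsup>kd\<^esup>\<close> points of the dyadic cubes \<open>[2\<^sup>k, 2\<^bsup>k+1\<^esup>)\<^sup>d\<close> bounds
  \<open>\<Sum>k. 2\<^bsup>kd\<^esup> \<alpha>\<^sup>-\<^sup>1 (2\<^bsup>-k\<^esup>)\<close>, which dominates the integral.
\<close>

section \<open>Slowly varying summable functions on the integer lattice\<close>

text \<open>On the dyadic interval from \<open>1 / 2 ^ Suc k\<close> to \<open>1 / 2 ^ k\<close> the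
  integrand is at most \<open>\<beta> (1 / 2 ^ k) * (2 ^ Suc k) ^ (d + 1)\<close>. Multiplying by
  the length leaves \<open>2 ^ d\<close> times the k-th term of the series. The intervals share
  endpoints, which is harmless for an upper bound.\<close>

lemma nn_integral_dyadic_finite:
  fixes \<beta> :: "real \<Rightarrow> real"
  assumes mono: "mono_on {0..1} \<beta>" and nonneg: "0 \<le> \<beta> 0"
    and summable: "summable (\<lambda>k. 2 ^ (k * d) * \<beta> (1 / 2 ^ k))"
  shows "(\<integral>\<^sup>+ t\<in>{0..1}. ennreal (\<beta> t / t ^ (d + 1)) \<partial>lborel) < \<infinity>"
proof -
  define A :: "nat \<Rightarrow> real set" where "A k = {1 / 2 ^ Suc k..1 / 2 ^ k}" for k
  define c where "c k = \<beta> (1 / 2 ^ k) * (2 ^ Suc k) ^ (d + 1)" for k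
  have \<beta>_nonneg: "0 \<le> \<beta> (1 / 2 ^ k)" for k :: nat
  proof -
    have "\<beta> 0 \<le> \<beta> (1 / 2 ^ k)"
      by (rule mono_onD[OF mono]) auto
    then show ?thesis using nonneg by simp
  qed
  have c_nonneg: "0 \<le> c k" for k
    unfolding c_def using \<beta>_nonneg[of k] by simp
  have pointwise: "ennreal (\<beta> t / t ^ (d + 1)) * indicator {0..1} t
      \<le> (\<Sum>k. ennreal (c k) * indicator (A k) t)" for t :: real
  proof (cases "0 < t \<and> t \<le> 1")
    case True
    \<comment> \<open>The least such \<open>n\<close> locates \<open>t\<close> in a dyadic interval;
      it is nonzero because \<open>t \<le> 1\<close>.\<close>
    have "\<exists>n. (1 / 2) ^ n < t"
      using True by (intro real_arch_pow_inv) auto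
    then obtain n where n: "(1 / 2) ^ n < t" "\<And>m. m < n \<Longrightarrow> \<not> (1 / 2) ^ m < t"
      using exists_least_iff[of "\<lambda>n. (1 / 2) ^ n < t"] by blast
    have "n \<noteq> 0" using n(1) True by (intro notI) simp
    then obtain k where k: "n = Suc k" by (cases n) auto
    have lo: "1 / 2 ^ Suc k < t" and hi: "t \<le> 1 / 2 ^ k"
      using n(1) n(2)[of k] by (simp_all add: k power_divide not_less)
    have "\<beta> t \<le> \<beta> (1 / 2 ^ k)"
      using True hi by (intro mono_onD[OF mono]) auto
    moreover have "1 / t ^ (d + 1) \<le> (2 ^ Suc k) ^ (d + 1)"
    proof -
      have "1 / t \<le> 2 ^ Suc k"
        using lo True by (simp add: field_simps)
      then have "(1 / t) ^ (d + 1) \<le> (2 ^ Suc k) ^ (d + 1)"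
        using True by (intro power_mono) auto
      then show ?thesis by (simp add: power_divide)
    qed
    ultimately have "\<beta> t * (1 / t ^ (d + 1)) \<le> c k"
      unfolding c_def using \<beta>_nonneg[of k] True by (intro mult_mono) auto
    then have "ennreal (\<beta> t / t ^ (d + 1)) * indicator {0..1} t
        \<le> ennreal (c k) * indicator (A k) t"
      using True lo hi by (simp add: A_def ennreal_leI)
    also have "\<dots> \<le> (\<Sum>k. ennreal (c k) * indicator (A k) t)"
      using sum_le_suminf[OF summableI, of "{k}" "\<lambda>k. ennreal (c k) * indicator (A k) t"]
      by (simp only: sum.insert sum.empty finite.intros empty_iff not_False_eq_True add_0_right
          zero_le simp_thms ball_simps)
    finally show ?thesis .
  next
    case False
    then have "t \<le> 0 \<or> t > 1" by auto
    \<comment> \<open>At \<open>t = 0\<close> the quotient is 0 by the convention for division by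
      zero; at the other points the indicator vanishes.\<close>
    then show ?thesis by (cases "t = 0") auto
  qed
  have "(\<integral>\<^sup>+ t\<in>{0..1}. ennreal (\<beta> t / t ^ (d + 1)) \<partial>lborel)
      \<le> (\<integral>\<^sup>+ t. (\<Sum>k. ennreal (c k) * indicator (A k) t) \<partial>lborel)"
    by (intro nn_integral_mono) (rule pointwise)
  also have "\<dots> = (\<Sum>k. \<integral>\<^sup>+ t. ennreal (c k) * indicator (A k) t \<partial>lborel)"
    by (intro nn_integral_suminf) (simp add: A_def)
  also have "\<dots> = (\<Sum>k. ennreal (2 ^ d * (2 ^ (k * d) * \<beta> (1 / 2 ^ k))))"
  proof (intro suminf_cong)
    fix k
    have "(\<integral>\<^sup>+ t. ennreal (c k) * indicator (A k) t \<partial>lborel) = ennreal (c k) * emeasure lborel (A k)"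
      by (intro nn_integral_cmult_indicator) (simp add: A_def)
    also have "emeasure lborel (A k) = ennreal (1 / 2 ^ Suc k)"
      unfolding A_def by (subst emeasure_lborel_Icc) (auto simp: field_simps)
    also have "ennreal (c k) * ennreal (1 / 2 ^ Suc k) = ennreal (c k * (1 / 2 ^ Suc k))"
      using c_nonneg by (intro ennreal_mult[symmetric]) auto
    also have "c k * (1 / 2 ^ Suc k) = 2 ^ d * (2 ^ (k * d) * \<beta> (1 / 2 ^ k))"
      unfolding c_def by (simp add: power_mult_distrib field_simps flip: power_mult)
    finally show "(\<integral>\<^sup>+ t. ennreal (c k) * indicator (A k) t \<partial>lborel)
        = ennreal (2 ^ d * (2 ^ (k * d) * \<beta> (1 / 2 ^ k)))" .
  qed
  also have "\<dots> < \<infinity>"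
    using summable_mult[OF summable, of "2 ^ d"] \<beta>_nonneg
    by (subst suminf_ennreal2) auto
  finally show ?thesis .
qed

lemma card_int_cube:
  "card {g :: int ^ 'd. \<forall>i. g $ i \<in> X} = card X ^ CARD('d)"
proof -
  have "bij_betw vec_lambda (PiE UNIV (\<lambda>_ :: 'd. X)) {g :: int ^ 'd. \<forall>i. g $ i \<in> X}"
    by (rule bij_betw_byWitness[of _ "\<lambda>g. ($) g"]) (auto simp: vec_eq_iff)
  then have "card {g :: int ^ 'd. \<forall>i. g $ i \<in> X} = card (PiE UNIV (\<lambda>_ :: 'd. X))"
    by (simp add: bij_betw_same_card)
  then show ?thesis by (simp add: card_PiE)
qed

lemma finite_int_cube:
  assumes "finite X"
  shows "finite {g :: int ^ 'd. \<forall>i. g $ i \<in> X}"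
proof -
  have "{g :: int ^ 'd. \<forall>i. g $ i \<in> X} \<subseteq> vec_lambda ` PiE UNIV (\<lambda>_. X)"
  proof
    fix g :: "int ^ 'd" assume "g \<in> {g. \<forall>i. g $ i \<in> X}"
    then show "g \<in> vec_lambda ` PiE UNIV (\<lambda>_. X)"
      by (intro image_eqI[of _ _ "($) g"]) auto
  qed
  moreover have "finite (PiE (UNIV :: 'd set) (\<lambda>_. X))"
    using assms by (intro finite_PiE) auto
  ultimately show ?thesis
    using finite_surj by blast
qed

text \<open>
  The bound is run from \<open>g\<close> back to the origin: \<open>x * (1 + \<epsilon>)\<close> is monotone in \<open>x\<close>, so the argument
  survives even if \<open>L\<close> is not monotone along the path.
\<close>

lemma bound_at_origin_of_slow_growth:
  fixes L :: "int ^ 'd \<Rightarrow> real" and \<epsilon> a :: real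
  assumes step: "\<And>g i. L g < 2 * a \<Longrightarrow> L (g - axis i 1) \<le> L g * (1 + \<epsilon>)"
    and "0 \<le> \<epsilon>" "0 < b"
    and "b * (1 + \<epsilon>) ^ n \<le> 2 * a" and "\<forall>i. 0 \<le> g $ i" and "(\<Sum>i\<in>UNIV. g $ i) = int n"
    and "L g < b"
  shows "L 0 < 2 * a"
  using assms(3-)
proof (induction n arbitrary: b g)
  case 0
  have "g = 0"
    using sum_nonneg_eq_0_iff[of "UNIV :: 'd set" "\<lambda>i. g $ i"] "0.prems" by (simp add: vec_eq_iff)
  then show ?case using "0.prems" by simp
next
  case (Suc n)
  have "\<exists>i. g $ i \<noteq> 0"
  proof (rule ccontr)
    assume "\<nexists>i. g $ i \<noteq> 0"
    then show False using Suc.prems(4) by simp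
  qed
  then obtain i where i: "g $ i \<noteq> 0" by blast
  have b: "b * (1 + \<epsilon>) * (1 + \<epsilon>) ^ n \<le> 2 * a"
    using Suc.prems(2) by (simp add: mult.assoc)
  \<comment> \<open>Hence \<open>b \<le> 2 * a\<close>, which is what allows \<open>step\<close> to
    be applied at \<open>g\<close>.\<close>
  have "b * 1 \<le> b * (1 + \<epsilon>) ^ Suc n"
    using Suc.prems(1) \<open>0 \<le> \<epsilon>\<close> by (intro mult_left_mono one_le_power) auto
  then have "L g < 2 * a"
    using Suc.prems(2,5) by simp
  then have "L (g - axis i 1) \<le> L g * (1 + \<epsilon>)" by (rule step)
  also have "\<dots> < b * (1 + \<epsilon>)"
    using Suc.prems(5) \<open>0 \<le> \<epsilon>\<close> by (intro mult_strict_right_mono) auto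
  finally have L: "L (g - axis i 1) < b * (1 + \<epsilon>)" .
  have "0 < g $ i" using i Suc.prems(3) by (simp add: order_less_le)
  then have nonneg: "\<forall>j. 0 \<le> (g - axis i 1) $ j"
    using Suc.prems(3) by (auto simp: axis_def)
  have "(\<Sum>j\<in>UNIV. (g - axis i 1) $ j) = (\<Sum>j\<in>UNIV. g $ j) - (\<Sum>j\<in>UNIV. axis i 1 $ j)"
    by (simp add: sum_subtractf)
  also have "(\<Sum>j\<in>UNIV. axis i (1 :: int) $ j) = 1"
    by (simp add: axis_def if_distrib cong: if_cong)
  finally have sum: "(\<Sum>j\<in>UNIV. (g - axis i 1) $ j) = int n"
    using Suc.prems(4) by simp
  show ?case
    using Suc.IH[OF _ b nonneg sum L] Suc.prems(1) \<open>0 \<le> \<epsilon>\<close> by simp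
qed

text \<open>A value below \<open>a k\<close> on the cube \<open>B k\<close> would at most double on
  the way back to the origin, since the path has at most \<open>d * 2 ^ Suc k\<close> steps. This
  contradicts \<open>2 * a k \<le> L 0\<close>, true for large \<open>k\<close>. So \<open>L\<close>
  is at least \<open>a k\<close> at each of the \<open>2 ^ (k * d)\<close> points of the
  cube.\<close>

lemma summable_of_slow_growth:
  fixes L :: "int ^ 'd \<Rightarrow> real" and \<alpha> \<beta> :: "real \<Rightarrow> real"
  assumes \<alpha>_mono: "mono_on {0..} \<alpha>" and \<alpha>_pos: "\<And>x. 0 < x \<Longrightarrow> 0 < \<alpha> x"
    and \<beta>_nonneg: "\<And>s. 0 \<le> s \<Longrightarrow> 0 \<le> \<beta> s" and \<alpha>_\<beta>: "\<And>s. 0 \<le> s \<Longrightarrow> \<alpha> (\<beta> s) = s"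
    and \<beta>_pos: "\<And>s. 0 < s \<Longrightarrow> 0 < \<beta> s"
    and "0 < m" "0 \<le> Q" and L_pos: "\<And>g. 0 < L g"
    and step: "\<And>g i. L (g - axis i 1) \<le> L g * (1 + Q * \<alpha> (L g / m))"
    and bounded: "\<And>A. finite A \<Longrightarrow> sum L A \<le> M"
  shows "summable (\<lambda>k. 2 ^ (k * CARD('d)) * \<beta> (1 / 2 ^ k))"
proof -
  define d where "d = CARD('d)"
  \<comment> \<open>The shift \<open>p\<close> absorbs all constants: it makes the total exponent
    \<open>d * 2 ^ Suc k * (Q * \<tau> k)\<close> at most 1/2.\<close>
  obtain p :: nat where p: "4 * d * Q \<le> 2 ^ p"
    using real_arch_pow[of 2 "4 * d * Q"] by (auto intro: less_imp_le)
  define \<tau> :: "nat \<Rightarrow> real" where "\<tau> k = 1 / 2 ^ (k + p)" for k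
  \<comment> \<open>With this choice \<open>L g < 2 * a k\<close> means
    \<open>L g / m < \<beta> (\<tau> k)\<close>, so the growth rate
    \<open>Q * \<alpha> (L g / m)\<close> is at most \<open>Q * \<tau> k\<close>.\<close>
  define a where "a k = m / 2 * \<beta> (\<tau> k)" for k
  have \<tau>_pos: "0 < \<tau> k" for k by (simp add: \<tau>_def)
  have a_pos: "0 < a k" for k
    using \<beta>_pos[OF \<tau>_pos] \<open>0 < m\<close> by (simp add: a_def)
  \<comment> \<open>Comparing on the side of \<open>\<alpha>\<close> avoids a separate proof that
    \<open>\<beta>\<close> tends to 0 at 0.\<close>
  obtain k0 where k0: "(1 / 2) ^ k0 < \<alpha> (L 0 / m)"
    using real_arch_pow_inv[of "\<alpha> (L 0 / m)" "1 / 2"] \<alpha>_pos[of "L 0 / m"] L_pos[of 0] \<open>0 < m\<close>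
    by auto
  have origin: "2 * a k \<le> L 0" if "k0 \<le> k" for k
  proof (rule ccontr)
    assume "\<not> 2 * a k \<le> L 0"
    then have "L 0 / m \<le> \<beta> (\<tau> k)"
      using \<open>0 < m\<close> by (simp add: a_def field_simps)
    then have "\<alpha> (L 0 / m) \<le> \<alpha> (\<beta> (\<tau> k))"
      using \<open>0 < m\<close> L_pos[of 0] \<beta>_nonneg[of "\<tau> k"] \<tau>_pos[of k]
      by (intro mono_onD[OF \<alpha>_mono]) auto
    also have "\<dots> = \<tau> k" using \<tau>_pos[of k] by (simp add: \<alpha>_\<beta>)
    also have "\<tau> k \<le> (1 / 2) ^ k0"
      using that by (simp add: \<tau>_def power_divide field_simps)
    finally show False using k0 by simp
  qed
  \<comment> \<open>Starting the coordinates at \<open>2 ^ k\<close> makes the cubes disjoint, so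
    that their contributions to the sum of \<open>L\<close> add up.\<close>
  define B :: "nat \<Rightarrow> (int ^ 'd) set" where "B k = {g. \<forall>i. g $ i \<in> {2 ^ k..<2 ^ Suc k}}" for k
  have card_B: "card (B k) = 2 ^ (k * d)" for k
    unfolding B_def card_int_cube d_def[symmetric]
    by (simp add: power_mult nat_diff_distrib nat_power_eq)
  have finite_B: "finite (B k)" for k
    unfolding B_def by (rule finite_int_cube) simp
  have disjoint_B: "B k \<inter> B l = {}" if "k \<noteq> l" for k l
  proof -
    have "B k \<inter> B l = {}" if "k < l" for k l
    proof (rule ccontr)
      assume "B k \<inter> B l \<noteq> {}"
      then obtain g where "g \<in> B k" "g \<in> B l" by blast
      then have "2 ^ l < (2 :: int) ^ Suc k"
        unfolding B_def by (metis (mono_tags, lifting) atLeastLessThan_iff mem_Collect_eq order_le_less_trans)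
      then have "l < Suc k" by (simp del: power_Suc)
      then show False using that by simp
    qed
    then show ?thesis using that by (metis Int_commute linorder_neqE_nat)
  qed
  have lower: "a k \<le> L g" if "k0 \<le> k" "g \<in> B k" for k g
  proof (rule ccontr)
    assume "\<not> a k \<le> L g"
    then have L: "L g < a k" by simp
    define \<epsilon> where "\<epsilon> = Q * \<tau> k"
    define n where "n = nat (\<Sum>i\<in>UNIV. g $ i)"
    have \<epsilon>_nonneg: "0 \<le> \<epsilon>" using \<open>0 \<le> Q\<close> \<tau>_pos[of k] by (simp add: \<epsilon>_def)
    have nonneg: "\<forall>i. 0 \<le> g $ i"
      using that(2) by (auto simp: B_def intro: order_trans[of _ "2 ^ k"])
    then have n: "(\<Sum>i\<in>UNIV. g $ i) = int n"
      by (simp add: n_def sum_nonneg)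
    have "(\<Sum>i\<in>UNIV. g $ i) \<le> (\<Sum>i\<in>(UNIV :: 'd set). 2 ^ Suc k)"
      using that(2) by (intro sum_mono) (auto simp: B_def intro: less_imp_le)
    then have "int n \<le> int d * 2 ^ Suc k"
      unfolding n by (simp add: d_def)
    then have n_le: "real n \<le> d * 2 ^ Suc k"
      using of_int_le_iff[where ?'a = real, of "int n" "int d * 2 ^ Suc k"] by simp
    have "(1 + \<epsilon>) ^ n \<le> exp \<epsilon> ^ n"
      using \<epsilon>_nonneg by (intro power_mono exp_ge_add_one_self) auto
    also have "\<dots> = exp (n * \<epsilon>)" by (simp add: exp_of_nat_mult)
    also have "n * \<epsilon> \<le> d * 2 ^ Suc k * \<epsilon>"
      using n_le \<epsilon>_nonneg by (intro mult_right_mono)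
    also have "\<dots> = 2 * d * Q / 2 ^ p"
      by (simp add: \<epsilon>_def \<tau>_def power_add)
    also have "\<dots> \<le> 1 / 2" using p by (simp add: field_simps)
    also have "exp (1 / 2) \<le> (2 :: real)" using exp_half_le2 .
    finally have "(1 + \<epsilon>) ^ n \<le> 2" by simp
    then have growth: "a k * (1 + \<epsilon>) ^ n \<le> 2 * a k"
      using a_pos[of k] by simp
    have "L (h - axis i 1) \<le> L h * (1 + \<epsilon>)" if "L h < 2 * a k" for h i
    proof -
      have "L h / m \<le> \<beta> (\<tau> k)"
        using that \<open>0 < m\<close> by (simp add: a_def field_simps)
      then have "\<alpha> (L h / m) \<le> \<alpha> (\<beta> (\<tau> k))"
        using \<open>0 < m\<close> L_pos[of h] \<beta>_nonneg[of "\<tau> k"] \<tau>_pos[of k]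
        by (intro mono_onD[OF \<alpha>_mono]) auto
      then have "Q * \<alpha> (L h / m) \<le> \<epsilon>"
        using \<open>0 \<le> Q\<close> \<tau>_pos[of k] by (simp add: \<alpha>_\<beta> \<epsilon>_def mult_left_mono)
      then have "L h * (1 + Q * \<alpha> (L h / m)) \<le> L h * (1 + \<epsilon>)"
        using L_pos[of h] by simp
      then show ?thesis using step[of h i] by linarith
    qed
    then have "L 0 < 2 * a k"
      using bound_at_origin_of_slow_growth[of L "a k" \<epsilon> "a k" n g] \<epsilon>_nonneg a_pos growth nonneg n L by blast
    then show False using origin[OF that(1)] by simp
  qed
  have "(\<Sum>j<n. 2 ^ ((j + k0) * d) * a (j + k0)) \<le> M" for n
  proof -
    have "(\<Sum>j<n. 2 ^ ((j + k0) * d) * a (j + k0)) = (\<Sum>j<n. \<Sum>g\<in>B (j + k0). a (j + k0))"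
      by (simp add: card_B)
    also have "\<dots> \<le> (\<Sum>j<n. \<Sum>g\<in>B (j + k0). L g)"
      by (intro sum_mono lower) auto
    also have "\<dots> = sum L (\<Union>j\<in>{..<n}. B (j + k0))"
      using finite_B disjoint_B by (subst sum.UNION_disjoint) auto
    also have "\<dots> \<le> M" using finite_B by (intro bounded) auto
    finally show ?thesis .
  qed
  then have "summable (\<lambda>j. 2 ^ ((j + k0) * d) * a (j + k0))"
    using a_pos by (intro summableI_nonneg_bounded) (auto simp: less_imp_le)
  then have "summable (\<lambda>k. 2 ^ (k * d) * a k)"
    by (subst (asm) summable_iff_shift)
  \<comment> \<open>The factor turns the series into the desired one with its index shifted by
    \<open>p\<close>.\<close>
  then have "summable (\<lambda>k. 2 / m * 2 ^ (p * d) * (2 ^ (k * d) * a k))"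
    by (rule summable_mult)
  also have "(\<lambda>k. 2 / m * 2 ^ (p * d) * (2 ^ (k * d) * a k))
      = (\<lambda>k. 2 ^ ((k + p) * d) * \<beta> (1 / 2 ^ (k + p)))"
    using \<open>0 < m\<close> by (auto simp: a_def \<tau>_def add_mult_distrib power_add)
  finally show ?thesis
    unfolding d_def by (subst (asm) summable_iff_shift)
qed

section \<open>Circle diffeomorphisms and their lifts\<close>

lemma dist_circle_of_le: "dist (circle_of s) (circle_of t) \<le> \<bar>s - t\<bar>"
  using round_diff_minimal[of "s - t" 0] by (simp add: dist_circle.abs_eq)

text \<open>Subtracting the rounded difference realises the circle distance on the line; this
  carries continuity of a lift down to the circle.\<close>

lemma circle_of_near_representative:
  obtains s where "y = circle_of s" "\<bar>s - t\<bar> = dist y (circle_of t)"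
proof -
  obtain s' where s': "y = circle_of s'" using circle_of_surj by blast
  let ?s = "s' - of_int (round (s' - t))"
  have "y = circle_of ?s" using s' by (simp add: circle_of_eq_iff)
  moreover have "\<bar>?s - t\<bar> = dist y (circle_of t)"
    by (simp add: s' dist_circle.abs_eq algebra_simps)
  ultimately show ?thesis using that by blast
qed

lemma continuous_on_circle_of: "continuous_on A circle_of"
  unfolding continuous_on_iff
  using dist_circle_of_le by (metis dist_real_def order_le_less_trans)

lemma continuous_on_of_lift:
  assumes "is_lift F f" "continuous_on UNIV F"
  shows "continuous_on UNIV f"
  unfolding continuous_on_iff
proof (intro ballI allI impI)
  fix x and e :: real
  assume "0 < e"
  obtain t where t: "x = circle_of t" using circle_of_surj by blast
  obtain d where "0 < d" and d: "\<And>s. dist s t < d \<Longrightarrow> dist (F s) (F t) < e"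
    using assms(2) \<open>0 < e\<close> unfolding continuous_on_iff by blast
  have "dist (f y) (f x) < e" if y: "dist y x < d" for y
  proof -
    obtain s where s: "y = circle_of s" "\<bar>s - t\<bar> = dist y (circle_of t)"
      using circle_of_near_representative .
    then have "\<bar>F s - F t\<bar> < e" using d[of s] y t by (simp add: dist_real_def)
    moreover have "dist (f y) (f x) \<le> \<bar>F s - F t\<bar>"
      using assms(1) dist_circle_of_le by (simp add: s(1) t is_lift_def)
    ultimately show ?thesis by linarith
  qed
  then show "\<exists>d>0. \<forall>y\<in>UNIV. dist y x < d \<longrightarrow> dist (f y) (f x) < e"
    using \<open>0 < d\<close> by blast
qed

section \<open>Topology of the circle and of the Cantor set\<close>

lemma circle_of_image_unit_interval: "circle_of ` {0..1} = UNIV"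
proof -
  have "x \<in> circle_of ` {0..1}" for x
  proof -
    obtain t where "x = circle_of t" using circle_of_surj by blast
    then have "x = circle_of (frac t)"
      by (simp add: circle_of_eq_iff frac_def)
    then show ?thesis by (simp add: frac_ge_0 less_imp_le frac_lt_1)
  qed
  then show ?thesis by blast
qed

lemma compact_UNIV_circle: "compact (UNIV :: circle set)"
  using compact_continuous_image[OF continuous_on_circle_of compact_Icc]
  by (metis circle_of_image_unit_interval)

lemma closed_image_circle:
  fixes f :: "circle \<Rightarrow> circle"
  assumes "continuous_on UNIV f" "closed C"
  shows "closed (f ` C)"
proof -
  have "compact C" using compact_Int_closed[OF compact_UNIV_circle assms(2)] by simp
  moreover have "continuous_on C f" using assms(1) by (rule continuous_on_subset) simp
  ultimately show ?thesis by (intro compact_imp_closed compact_continuous_image)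
qed

lemma connected_UNIV_circle: "connected (UNIV :: circle set)"
  using connected_continuous_image[OF continuous_on_circle_of connected_Icc]
  by (metis circle_of_image_unit_interval)

text \<open>A coordinate maps the Cantor set continuously onto two discrete points. Together with
  connectedness of the circle this shows that an exceptional minimal set is proper.\<close>

lemma not_connected_Cantor: "\<not> connected (UNIV :: (nat \<Rightarrow> bool) set)"
proof
  assume conn: "connected (UNIV :: (nat \<Rightarrow> bool) set)"
  have "connected (range (\<lambda>f :: nat \<Rightarrow> bool. f 0))"
    by (rule connected_continuous_image[OF continuous_on_product_coordinates conn])
  moreover have "range (\<lambda>f :: nat \<Rightarrow> bool. f 0) = {False, True}"
    by (auto intro: image_eqI[of _ _ "\<lambda>_. b" for b])
  ultimately show False
    using connectedD[of "{False, True}" "{False}" "{True}"] by (auto simp: open_discrete)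
qed

section \<open>Derivatives of circle maps\<close>

lemma is_lift_comp: "is_lift F f \<Longrightarrow> is_lift G g \<Longrightarrow> is_lift (F \<circ> G) (f \<circ> g)"
  by (simp add: is_lift_def)

text \<open>The definition of the derivative provides only some lift at some representative. An
  integer shift of the argument and an additive constant lead to the given lift and
  representative.\<close>

lemma has_derivative_of_lift:
  assumes "is_lift F f" "continuous_on UNIV F" "has_circle_derivative f D (circle_of t)"
  shows "(F has_real_derivative D) (at t)"
proof -
  obtain G s where G: "is_lift G f" "continuous_on UNIV G" "circle_of t = circle_of s"
      "(G has_real_derivative D) (at s)"
    using assms(3) unfolding has_circle_derivative_def by blast
  define k where "k = s - t"
  have k: "k \<in> \<int>" using G(3) by (metis circle_of_eq_iff k_def)
  have "circle_of (u + k) = circle_of u" for u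
    using k by (simp add: circle_of_eq_iff)
  then have "is_lift (\<lambda>u. G (u + k)) f"
    using G(1) by (simp add: is_lift_def) metis
  moreover have "continuous_on UNIV (\<lambda>u. G (u + k))"
    by (rule continuous_on_compose2[OF G(2)]) (auto intro!: continuous_intros)
  ultimately obtain c where c: "\<And>u. F u = G (u + k) + c"
    using continuous_lifts_differ_by_constant[OF assms(1,2)] by blast
  have "(G has_real_derivative D) (at (t + k))" using G(4) by (simp add: k_def)
  then have "((\<lambda>u. G (u + k) + c) has_real_derivative D) (at t)"
    by (auto intro!: derivative_eq_intros simp: DERIV_shift)
  then show ?thesis using c by presburger
qed

lemma has_circle_derivative_comp:
  assumes "has_circle_derivative f E (g x)" "has_circle_derivative g D x"
  shows "has_circle_derivative (f \<circ> g) (E * D) x"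
proof -
  obtain F where F: "is_lift F f" "continuous_on UNIV F"
    using assms(1) unfolding has_circle_derivative_def by blast
  obtain G t where G: "is_lift G g" "continuous_on UNIV G" "x = circle_of t"
      "(G has_real_derivative D) (at t)"
    using assms(2) unfolding has_circle_derivative_def by blast
  have "has_circle_derivative f E (circle_of (G t))"
    using assms(1) G(1,3) by (simp add: is_lift_def)
  then have "(F has_real_derivative E) (at (G t))"
    by (rule has_derivative_of_lift[OF F])
  then have "(F \<circ> G has_real_derivative E * D) (at t)"
    using G(4) by (rule DERIV_chain)
  moreover have "continuous_on UNIV (F \<circ> G)"
    using F(2) G(2) by (intro continuous_on_compose) (auto intro: continuous_on_subset)
  ultimately show ?thesis
    unfolding has_circle_derivative_def using is_lift_comp[OF F(1) G(1)] G(3) by blast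
qed

lemma has_circle_derivative_rotation: "has_circle_derivative (rotation a) 1 x"
proof -
  obtain t where "x = circle_of t" using circle_of_surj by blast
  moreover have "is_lift (\<lambda>t. t + a) (rotation a)"
    by (simp add: is_lift_def rotation_circle_of)
  moreover have "continuous_on UNIV (\<lambda>t :: real. t + a)"
    by (intro continuous_intros)
  moreover have "((\<lambda>t. t + a) has_real_derivative 1) (at t)"
    by (auto intro!: derivative_eq_intros)
  ultimately show ?thesis unfolding has_circle_derivative_def by blast
qed

lemma rotation_0: "rotation 0 = id"
  by (metis add_0_right circle_of_surj eq_id_iff rotation_circle_of)

lemma C1_circle_map_has_derivative:
  "C1_circle_map f \<Longrightarrow> has_circle_derivative f (circle_deriv f x) x"
  unfolding C1_circle_map_def using circle_deriv_eq by metis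

lemma Diff1_has_derivative: "f \<in> Diff1 \<Longrightarrow> has_circle_derivative f (circle_deriv f x) x"
  by (simp add: Diff1_def C1_circle_map_has_derivative)

lemma circle_deriv_comp_Diff1:
  "f \<in> Diff1 \<Longrightarrow> g \<in> Diff1 \<Longrightarrow> circle_deriv (f \<circ> g) x = circle_deriv f (g x) * circle_deriv g x"
  by (intro circle_deriv_eq has_circle_derivative_comp Diff1_has_derivative)

lemma circle_deriv_id: "circle_deriv id x = 1"
  using circle_deriv_eq[OF has_circle_derivative_rotation, of 0] by (simp add: rotation_0)

lemma Diff1_lift:
  assumes "f \<in> Diff1"
  obtains F where "is_lift F f" "continuous_on UNIV F" "strict_mono F"
    "\<And>t. (F has_real_derivative circle_deriv f (circle_of t)) (at t)"
  using assms has_derivative_of_lift Diff1_has_derivative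
  unfolding Diff1_def orientation_preserving_def by blast

text \<open>Monotonicity of a lift gives only a nonnegative derivative; the chain rule for
  \<open>inv f \<circ> f\<close> excludes zero.\<close>

lemma Diff1_deriv_pos:
  assumes "f \<in> Diff1"
  shows "0 < circle_deriv f x"
proof -
  obtain F where F: "strict_mono F" "\<And>t. (F has_real_derivative circle_deriv f (circle_of t)) (at t)"
    using Diff1_lift[OF assms] by blast
  obtain t where t: "x = circle_of t" using circle_of_surj by blast
  have "0 \<le> circle_deriv f x"
    using F unfolding t
    by (intro mono_on_imp_deriv_nonneg[of UNIV F]) (auto simp: strict_mono_mono)
  moreover have "circle_deriv f x \<noteq> 0"
  proof -
    have "bij f" "C1_circle_map (inv f)" using assms by (auto simp: Diff1_def)
    then have "has_circle_derivative (inv f \<circ> f) (circle_deriv (inv f) (f x) * circle_deriv f x) x"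
      by (intro has_circle_derivative_comp C1_circle_map_has_derivative Diff1_has_derivative assms)
    then have "circle_deriv (inv f) (f x) * circle_deriv f x = 1"
      using circle_deriv_eq circle_deriv_id \<open>bij f\<close> by (metis bij_is_inj inv_o_cancel)
    then show ?thesis by auto
  qed
  ultimately show ?thesis by simp
qed

lemma Diff1_continuous: "f \<in> Diff1 \<Longrightarrow> continuous_on UNIV f"
  by (metis Diff1_lift continuous_on_of_lift)

text \<open>Surjectivity of \<open>H\<close> and commutation with integer translations make the
  monotone lift surjective onto the line, and a monotone function without gaps in its range is
  continuous.\<close>

lemma monotone_degree_one_lift:
  assumes "monotone_degree_one H" "surj H"
  obtains P where "is_lift P H" "mono P" "continuous_on UNIV P" "\<And>t. P (t + 1) = P t + 1"
proof -
  obtain P where P: "is_lift P H" "mono P" and P1: "\<And>t. P (t + 1) = P t + 1"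
    using assms(1) unfolding monotone_degree_one_def by blast
  have Pnat: "P (t + of_nat n) = P t + of_nat n" for t n
  proof (induction n)
    case (Suc n)
    show ?case using P1[of "t + of_nat n"] Suc by (simp add: ac_simps)
  qed simp
  have Pint: "P (t + of_int n) = P t + of_int n" for t n
  proof (cases "0 \<le> n")
    case True
    then show ?thesis using Pnat[of t "nat n"] by simp
  next
    case False
    then show ?thesis using Pnat[of "t + of_int n" "nat (- n)"] by simp
  qed
  have "r \<in> range P" for r
  proof -
    obtain x where "H x = circle_of r" using assms(2) by (metis surjD)
    moreover obtain t where "x = circle_of t" using circle_of_surj by blast
    ultimately have "circle_of r = circle_of (P t)" using P(1) by (simp add: is_lift_def)
    then obtain n where "r - P t = of_int n" by (auto simp: circle_of_eq_iff elim: Ints_cases)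
    then have "P (t + of_int n) = r" by (simp add: Pint)
    then show ?thesis by blast
  qed
  then have "range P = UNIV" by blast
  then have "continuous_on UNIV P"
    using P(2) by (intro continuous_onI_mono) (auto dest: monoD)
  then show ?thesis using that P P1 by blast
qed

text \<open>Integer translations move the left endpoints into the unit interval, which yields
  disjoint intervals inside \<open>{0..2}\<close>. The bound 2 instead of 1 spares cutting the arcs
  that cross an integer.\<close>

lemma sum_lengths_le_of_disjoint_arcs:
  fixes u v :: "'a \<Rightarrow> real"
  assumes "finite A" and le: "\<And>g. g \<in> A \<Longrightarrow> u g \<le> v g" and short: "\<And>g. g \<in> A \<Longrightarrow> v g - u g \<le> 1"
    and disjoint: "\<And>g g'. g \<in> A \<Longrightarrow> g' \<in> A \<Longrightarrow> g \<noteq> g' \<Longrightarrow>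
      circle_of ` {u g..v g} \<inter> circle_of ` {u g'..v g'} = {}"
  shows "(\<Sum>g\<in>A. v g - u g) \<le> 2"
proof -
  define n where "n g = real_of_int \<lfloor>u g\<rfloor>" for g
  define I where "I g = {u g - n g..v g - n g}" for g
  have I_arc: "circle_of t \<in> circle_of ` {u g..v g}" if "t \<in> I g" for t g
  proof
    show "circle_of t = circle_of (t + n g)" by (simp add: circle_of_eq_iff n_def)
    show "t + n g \<in> {u g..v g}" using that by (simp add: I_def algebra_simps)
  qed
  have disj: "disjoint_family_on I A"
    unfolding disjoint_family_on_def using I_arc disjoint by blast
  have sub: "I g \<subseteq> {0..2}" if "g \<in> A" for g
  proof -
    have "n g \<le> u g" "u g < n g + 1" unfolding n_def by linarith+
    then show ?thesis using short[OF that] by (auto simp: I_def)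
  qed
  have "(\<Sum>g\<in>A. v g - u g) = (\<Sum>g\<in>A. measure lborel (I g))"
    using le by (intro sum.cong) (auto simp: I_def)
  also have "\<dots> = measure lborel (\<Union>g\<in>A. I g)"
    by (rule measure_finite_Union[OF assms(1) _ disj, symmetric])
      (auto simp: I_def emeasure_lborel_Icc_eq)
  also have "\<dots> \<le> measure lborel {0..2 :: real}"
  proof (rule measure_mono_fmeasurable)
    show "(\<Union>g\<in>A. I g) \<subseteq> {0..2}" using sub by blast
    show "(\<Union>g\<in>A. I g) \<in> sets lborel" using assms(1) by (auto simp: I_def)
    show "{0..2 :: real} \<in> fmeasurable lborel" by (simp add: fmeasurable_def)
  qed
  finally show ?thesis by simp
qed

section \<open>Actions semi-conjugate to rotations\<close>

lemma irrational_rotation_orbit_dense: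
  assumes "a \<notin> \<rat>" "closed C" and orbit: "\<And>n :: nat. rotation (of_nat n * a) z \<in> C"
  shows "C = UNIV"
proof -
  obtain t where t: "z = circle_of t" using circle_of_surj by blast
  have "w \<in> closure C" for w
    unfolding closure_approachable
  proof (intro allI impI)
    fix e :: real assume "0 < e"
    obtain r where r: "w = circle_of r" using circle_of_surj by blast
    \<comment> \<open>Positivity of \<open>k\<close> matters: the orbit hypothesis covers only
      natural multiples of \<open>a\<close>.\<close>
    obtain q k :: int where k: "k > 0" "\<bar>of_int k * a - of_int q - (r - t)\<bar> < e"
      using sequence_of_fractional_parts_is_dense[OF assms(1) \<open>0 < e\<close>] by blast
    define n where "n = nat k"
    have n: "of_nat n = (of_int k :: real)" using k(1) by (simp add: n_def)
    have "rotation (of_nat n * a) z = circle_of (t + of_int k * a - of_int q)"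
      by (simp add: t n rotation_circle_of circle_of_eq_iff)
    then have "dist (rotation (of_nat n * a) z) w \<le> \<bar>t + of_int k * a - of_int q - r\<bar>"
      using dist_circle_of_le by (simp add: r)
    also have "\<dots> < e" using k(2) by (simp add: algebra_simps)
    finally show "\<exists>y\<in>C. dist y w < e" using orbit by blast
  qed
  then show ?thesis using assms(2) by auto
qed

lemma conjugate_rotation_apply:
  assumes "h \<in> Diff1" "h \<circ> f \<circ> inv h = rotation a"
  shows "h (f y) = rotation a (h y)"
proof -
  have "inv h (h y) = y" using assms(1) by (simp add: Diff1_def bij_is_inj)
  then show ?thesis using fun_cong[OF assms(2), of "h y"] by simp
qed

text \<open>Two rotations that agree at one point are equal, so freeness follows from
  faithfulness.\<close>

lemma conjugate_into_rotations_free: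
  assumes "h \<in> Diff1" "inj \<sigma>" and "\<And>g. h \<circ> \<sigma> g \<circ> inv h = rotation (r g)"
    and "\<sigma> g y = \<sigma> g' y"
  shows "g = g'"
proof -
  obtain t where t: "h y = circle_of t" using circle_of_surj by blast
  have h: "h (\<sigma> g x) = rotation (r g) (h x)" for g x
    using conjugate_rotation_apply[OF assms(1,3)] .
  have "circle_of (t + r g) = circle_of (t + r g')"
    using h[of g y] h[of g' y] assms(4) by (simp add: t rotation_circle_of)
  then have "r g - r g' \<in> \<int>" by (simp add: circle_of_eq_iff)
  then have "rotation (r g) x = rotation (r g') x" for x
    by (metis circle_of_surj rotation_circle_of circle_of_eq_iff add_diff_cancel_left)
  then have "h (\<sigma> g x) = h (\<sigma> g' x)" for x by (simp add: h)
  moreover have "inj h" using assms(1) by (simp add: Diff1_def bij_is_inj)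
  ultimately have "\<sigma> g = \<sigma> g'" by (simp add: fun_eq_iff inj_eq)
  then show ?thesis using assms(2) by (simp add: inj_eq)
qed

text \<open>One coordinate direction suffices. Its rotation angle \<open>a\<close> is irrational,
  since a rational angle would let a nonzero multiple of the unit vector fix \<open>y\<close>,
  against freeness.\<close>

lemma free_rotation_action_minimal:
  fixes \<sigma> :: "int ^ 'd \<Rightarrow> circle \<Rightarrow> circle"
  assumes "action_in G \<sigma>" "inj \<sigma>" "h \<in> Diff1" and conj: "\<And>g. h \<circ> \<sigma> g \<circ> inv h = rotation (r g)"
    and "closed C" "y \<in> C" and inv: "\<And>g x. x \<in> C \<Longrightarrow> \<sigma> g x \<in> C"
  shows "C = UNIV"
proof -
  \<comment> \<open>Here \<open>undefined\<close> merely names an arbitrary coordinate; index types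
    are nonempty.\<close>
  define e :: "nat \<Rightarrow> int ^ 'd" where "e n = axis undefined (int n)" for n
  define e1 :: "int ^ 'd" where "e1 = axis undefined 1"
  define a where "a = r e1"
  have \<sigma>_0: "\<sigma> 0 = id" and \<sigma>_add: "\<And>g g'. \<sigma> (g + g') = \<sigma> g \<circ> \<sigma> g'"
    using assms(1) by (auto simp: action_in_def)
  have h: "h (\<sigma> g x) = rotation (r g) (h x)" for g x
    using conjugate_rotation_apply[OF assms(3) conj] .
  have inj_h: "inj h" and surj_h: "surj h"
    using assms(3) by (auto simp: Diff1_def bij_is_inj bij_is_surj)
  have e_Suc: "e (Suc n) = e1 + e n" for n
    by (simp add: e_def e1_def vec_eq_iff axis_def)
  have e_0: "e 0 = 0" by (simp add: e_def vec_eq_iff axis_def)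
  have h_e: "h (\<sigma> (e n) x) = rotation (of_nat n * a) (h x)" for n x
  proof (induction n)
    case 0
    then show ?case by (simp add: e_0 \<sigma>_0 rotation_0)
  next
    case (Suc n)
    obtain t where "h x = circle_of t" using circle_of_surj by blast
    moreover have "h (\<sigma> (e (Suc n)) x) = rotation a (h (\<sigma> (e n) x))"
      by (simp add: e_Suc \<sigma>_add h a_def)
    ultimately show ?case by (simp add: Suc rotation_circle_of algebra_simps)
  qed
  have "a \<notin> \<rat>"
  proof
    assume "a \<in> \<rat>"
    then obtain m n :: int where mn: "n > 0" "a = of_int m / of_int n"
      by (rule Rats_cases')
    define q where "q = nat n"
    have "of_nat q * a = of_int m" using mn by (simp add: q_def)
    then have "h (\<sigma> (e q) y) = rotation (of_int m) (h y)" using h_e[of q y] by simp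
    also have "\<dots> = h y"
      by (metis Ints_of_int add_diff_cancel_left' circle_of_eq_iff circle_of_surj rotation_circle_of)
    finally have "\<sigma> (e q) y = \<sigma> 0 y" using inj_h \<sigma>_0 by (simp add: inj_eq)
    then have "e q = 0"
      using conjugate_into_rotations_free[OF assms(3,2) conj] by blast
    then have "q = 0" by (simp add: e_def vec_eq_iff axis_def split: if_splits)
    then show False using mn(1) by (simp add: q_def)
  qed
  moreover have "closed (h ` C)"
    using Diff1_continuous[OF assms(3)] assms(5) by (rule closed_image_circle)
  moreover have "rotation (of_nat n * a) (h y) \<in> h ` C" for n
    using inv[OF assms(6)] h_e[of n y] by (metis imageI)
  ultimately have "h ` C = UNIV" by (rule irrational_rotation_orbit_dense)
  then show ?thesis using inj_h by (metis inj_image_eq_iff surj_h)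
qed

text \<open>By minimality \<open>H\<close> maps \<open>K\<close> onto the circle, so a point outside
  \<open>K\<close> has the same image as some point of \<open>K\<close>. A monotone lift of
  \<open>H\<close> is constant between suitable representatives of the two.\<close>

lemma ex_collapsed_arc:
  fixes \<rho> \<sigma> :: "int ^ 'd \<Rightarrow> circle \<Rightarrow> circle"
  assumes "exceptional_minimal_set \<rho> K" "action_in G \<sigma>" "inj \<sigma>"
    and h: "h \<in> Diff1" "\<And>g. h \<circ> \<sigma> g \<circ> inv h = rotation (r g)"
    and "semi_conjugacy H \<rho> \<sigma>"
  obtains u v w where "u < v" "v < u + 1" "u \<le> w" "w \<le> v" "circle_of w \<in> K"
    "\<And>t. u \<le> t \<Longrightarrow> t \<le> v \<Longrightarrow> H (circle_of t) = H (circle_of w)"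
proof -
  have K: "K \<noteq> {}" "closed K" "\<And>g. \<rho> g ` K = K"
    and Cantor: "K homeomorphic (UNIV :: (nat \<Rightarrow> bool) set)"
    using assms(1) by (auto simp: exceptional_minimal_set_def minimal_set_def invariant_set_def)
  have surj: "surj H" and deg1: "monotone_degree_one H"
    and equi: "\<And>g x. H (\<rho> g x) = \<sigma> g (H x)"
    using assms(6) by (auto simp: semi_conjugacy_def fun_eq_iff)
  obtain P where P: "is_lift P H" "mono P" "continuous_on UNIV P" "\<And>t. P (t + 1) = P t + 1"
    using monotone_degree_one_lift[OF deg1 surj] by metis
  have "closed (H ` K)"
    using continuous_on_of_lift[OF P(1,3)] K(2) by (rule closed_image_circle)
  moreover have "\<sigma> g y \<in> H ` K" if y: "y \<in> H ` K" for g y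
  proof -
    obtain x where "x \<in> K" "y = H x" using y by blast
    then show ?thesis using equi[of g x] K(3)[of g] by (metis imageI)
  qed
  moreover obtain x0 where "H x0 \<in> H ` K" using K(1) by blast
  ultimately have HK: "H ` K = UNIV"
    using free_rotation_action_minimal[OF assms(2,3) h, of "H ` K" "H x0"] by blast
  have "K \<noteq> UNIV"
    using homeomorphic_connectedness[OF Cantor] connected_UNIV_circle not_connected_Cantor by auto
  then obtain z where z: "z \<notin> K" by blast
  obtain x where x: "x \<in> K" "H x = H z" using HK by (metis UNIV_I imageE)
  obtain w where w: "x = circle_of w" using circle_of_surj by blast
  obtain s' where s': "z = circle_of s'" using circle_of_surj by blast
  have Pn: "P (t + of_int n) = P t + of_int n" for t n
  proof (induction n rule: int_induct[where k = 0])
    case (step1 i)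
    then show ?case using P(4)[of "t + of_int i"] by (simp add: add.assoc)
  next
    case (step2 i)
    then show ?case using P(4)[of "t + of_int (i - 1)"] by (simp add: add.assoc)
  qed simp
  have "circle_of (P w) = circle_of (P s')"
    using P(1) x(2) by (simp add: is_lift_def w s')
  then obtain n where n: "P w - P s' = of_int n" by (auto simp: circle_of_eq_iff elim: Ints_cases)
  \<comment> \<open>The representative of \<open>z\<close> is moved by an integer so that
    \<open>P\<close> takes equal values at \<open>s\<close> and \<open>w\<close>, not just values
    equal modulo 1.\<close>
  define s where "s = s' + of_int n"
  have s: "z = circle_of s" "P s = P w"
    using n by (auto simp: s_def s' circle_of_eq_iff Pn)
  have "s \<noteq> w" using s w x z by auto
  define u v where "u = min s w" and "v = max s w"
  have Puv: "P u = P w" "P v = P w" using s(2) by (auto simp: u_def v_def min_def max_def)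
  show ?thesis
  proof
    show "u < v" "u \<le> w" "w \<le> v" using \<open>s \<noteq> w\<close> by (auto simp: u_def v_def)
    show "circle_of w \<in> K" using x w by simp
    show "v < u + 1"
    proof (rule ccontr)
      assume "\<not> v < u + 1"
      then have "P (u + 1) \<le> P v" using P(2) by (simp add: monoD)
      then show False using P(4)[of u] Puv by simp
    qed
    fix t assume "u \<le> t" "t \<le> v"
    then have "P t = P w" using P(2) Puv by (metis monoD order_antisym)
    then show "H (circle_of t) = H (circle_of w)"
      using P(1) by (simp add: is_lift_def)
  qed
qed

text \<open>Differentiate \<open>h \<circ> f = rotation a \<circ> h\<close>; a rotation has
  derivative 1.\<close>

lemma conjugacy_deriv_cocycle:
  assumes "h \<in> Diff1" "f \<in> Diff1" "h \<circ> f \<circ> inv h = rotation a"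
  shows "circle_deriv f y = circle_deriv h y / circle_deriv h (f y)"
proof -
  have "h \<circ> f = rotation a \<circ> h"
    using conjugate_rotation_apply[OF assms(1,3)] by auto
  moreover have "has_circle_derivative (h \<circ> f) (circle_deriv h (f y) * circle_deriv f y) y"
    by (intro has_circle_derivative_comp Diff1_has_derivative assms)
  moreover have "has_circle_derivative (rotation a \<circ> h) (1 * circle_deriv h y) y"
    by (intro has_circle_derivative_comp Diff1_has_derivative has_circle_derivative_rotation assms)
  ultimately have "circle_deriv h (f y) * circle_deriv f y = circle_deriv h y"
    using has_circle_derivative_unique by fastforce
  then show ?thesis
    using Diff1_deriv_pos[OF assms(1), of "f y"] by (simp add: field_simps)
qed

text \<open>By the chain rule both derivatives are multiplicative cocycles, and equality of such
  cocycles along \<open>H\<close> passes from generators to differences.\<close>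

lemma derivs_agree_on_group_closure:
  fixes \<rho> \<sigma> :: "'g :: ab_group_add \<Rightarrow> circle \<Rightarrow> circle"
  assumes \<rho>: "action_in Diff1 \<rho>" and \<sigma>: "action_in Diff1 \<sigma>"
    and "invariant_set \<rho> K" and equi: "\<And>g x. H (\<rho> g x) = \<sigma> g (H x)"
    and S: "\<And>s x. s \<in> S \<Longrightarrow> x \<in> K \<Longrightarrow> circle_deriv (\<rho> s) x = circle_deriv (\<sigma> s) (H x)"
    and "g \<in> group_closure S" "x \<in> K"
  shows "circle_deriv (\<rho> g) x = circle_deriv (\<sigma> g) (H x)"
  using assms(6,7)
proof (induction g arbitrary: x)
  case (base s)
  then show ?case
    using S \<rho> \<sigma> by (auto simp: action_in_def circle_deriv_id simp del: id_apply simp flip: id_def)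
next
  case (diff g g')
  have K: "\<rho> (g - g') x \<in> K"
    using assms(3) diff.prems by (auto simp: invariant_set_def)
  \<comment> \<open>Writing \<open>g\<close> as \<open>g' + (g - g')\<close> avoids derivatives of
    inverses: the positive factor belonging to \<open>g'\<close> is cancelled at the end.\<close>
  have cocycle: "circle_deriv (\<tau> g) y = circle_deriv (\<tau> g') (\<tau> (g - g') y) * circle_deriv (\<tau> (g - g')) y"
    if "action_in Diff1 \<tau>" for \<tau> :: "'g \<Rightarrow> circle \<Rightarrow> circle" and y
  proof -
    have "\<tau> g = \<tau> g' \<circ> \<tau> (g - g')"
    proof -
      have "\<tau> (g' + (g - g')) = \<tau> g' \<circ> \<tau> (g - g')"
        using that unfolding action_in_def by blast
      then show ?thesis by simp
    qed
    moreover have "\<tau> g' \<in> Diff1" "\<tau> (g - g') \<in> Diff1"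
      using that unfolding action_in_def by blast+
    ultimately show ?thesis by (simp add: circle_deriv_comp_Diff1)
  qed
  have "circle_deriv (\<rho> g') (\<rho> (g - g') x) = circle_deriv (\<sigma> g') (\<sigma> (g - g') (H x))"
    using diff.IH(2)[OF K] by (simp add: equi)
  moreover have "0 < circle_deriv (\<sigma> g') (\<sigma> (g - g') (H x))"
    using \<sigma> by (intro Diff1_deriv_pos) (simp add: action_in_def)
  ultimately show ?case
    using cocycle[OF \<rho>, of x] cocycle[OF \<sigma>, of "H x"] diff.IH(1)[OF diff.prems] by simp
qed

section \<open>Distortion of arcs\<close>

text \<open>A concave function that decreases somewhere becomes negative far out, so nonnegativity
  forces monotonicity. The value 0 is attained, hence attained at 0, and injectivity makes all other
  values positive.\<close>

lemma concave_modulus_properties: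
  assumes "concave_modulus \<alpha>"
  shows concave_modulus_mono: "mono_on {0..} \<alpha>"
    and concave_modulus_0: "\<alpha> 0 = 0"
    and concave_modulus_pos: "\<And>x. 0 < x \<Longrightarrow> 0 < \<alpha> x"
    and concave_modulus_image: "\<alpha> ` {0..} = {0..}"
proof -
  obtain \<beta> where \<beta>: "homeomorphism {0..} {0..} \<alpha> \<beta>" and concave: "concave_on {0..} \<alpha>"
    using assms by (auto simp: concave_modulus_def)
  show image: "\<alpha> ` {0..} = {0..}" using \<beta> by (simp add: homeomorphism_def)
  have inj: "inj_on \<alpha> {0..}" using \<beta> by (meson homeomorphism_apply1 inj_onI inj_on_inverseI)
  have nonneg: "0 \<le> \<alpha> x" if "0 \<le> x" for x using image that by fastforce
  have le: "\<alpha> x \<le> \<alpha> y" if "0 \<le> x" "x \<le> y" for x y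
  proof (rule ccontr)
    assume "\<not> \<alpha> x \<le> \<alpha> y"
    then have less: "\<alpha> y < \<alpha> x" by simp
    have y_nonneg: "0 \<le> \<alpha> y" using nonneg that by simp
    \<comment> \<open>a far point \<open>z\<close> at which the chord from \<open>x\<close> through \<open>y\<close> would be negative\<close>
    define l where "l = (\<alpha> x - \<alpha> y) / (2 * \<alpha> x)"
    define z where "z = x + (y - x) / l"
    have l: "0 < l" "l \<le> 1" using less y_nonneg by (auto simp: l_def field_simps)
    have "0 \<le> (y - x) / l" using that l by simp
    then have z: "0 \<le> z" using that unfolding z_def by linarith
    have "(1 - l) * \<alpha> x + l * \<alpha> z \<le> \<alpha> ((1 - l) *\<^sub>R x + l *\<^sub>R z)"
      using concave_onD[OF concave, of l x z] l that z by simp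
    also have "(1 - l) *\<^sub>R x + l *\<^sub>R z = y"
      using l by (simp add: z_def field_simps)
    finally have "(1 - l) * \<alpha> x \<le> \<alpha> y"
      using nonneg[OF z] l by (smt (verit) mult_nonneg_nonneg)
    \<comment> \<open>The weight \<open>l\<close> was chosen to produce this midpoint, which exceeds
      \<open>\<alpha> y\<close>.\<close>
    moreover have "(1 - l) * \<alpha> x = (\<alpha> x + \<alpha> y) / 2"
      using less y_nonneg by (simp add: l_def field_simps)
    ultimately show False using less by simp
  qed
  show "mono_on {0..} \<alpha>" using le by (auto intro: mono_onI)
  obtain x where "0 \<le> x" "\<alpha> x = 0" using image by force
  then show zero: "\<alpha> 0 = 0" using le[of 0 x] nonneg[of 0] by simp
  show "0 < \<alpha> x" if "0 < x" for x
    using inj_onD[OF inj, of x 0] nonneg[of x] zero that by force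
qed

lemma modulus_continuous_bound:
  assumes "concave_modulus \<alpha>" "modulus_continuous \<alpha> g"
  obtains C where "0 \<le> C" "\<And>s t. \<bar>g (circle_of s) - g (circle_of t)\<bar> \<le> C * \<alpha> \<bar>s - t\<bar>"
proof -
  obtain C0 where C0: "\<And>x y. x \<noteq> y \<Longrightarrow> \<bar>g x - g y\<bar> / \<alpha> (dist x y) \<le> C0"
    using assms(2) unfolding modulus_continuous_def bdd_above_def by blast
  define C where "C = max 0 C0"
  note \<alpha> = concave_modulus_properties[OF assms(1)]
  have "\<bar>g (circle_of s) - g (circle_of t)\<bar> \<le> C * \<alpha> \<bar>s - t\<bar>" for s t
  proof (cases "circle_of s = circle_of t")
    case True
    have "0 \<le> \<alpha> \<bar>s - t\<bar>" using \<alpha>(4) by fastforce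
    then show ?thesis by (simp add: True C_def)
  next
    case False
    let ?d = "dist (circle_of s) (circle_of t)"
    have "0 < \<alpha> ?d" using False by (intro \<alpha>(3)) simp
    moreover have "\<bar>g (circle_of s) - g (circle_of t)\<bar> / \<alpha> ?d \<le> C"
      using C0[OF False] by (simp add: C_def)
    ultimately have "\<bar>g (circle_of s) - g (circle_of t)\<bar> \<le> C * \<alpha> ?d"
      by (simp add: divide_le_eq)
    also have "\<dots> \<le> C * \<alpha> \<bar>s - t\<bar>"
      by (intro mult_left_mono mono_onD[OF \<alpha>(1)] dist_circle_of_le) (auto simp: C_def)
    finally show ?thesis .
  qed
  moreover have "0 \<le> C" by (simp add: C_def)
  ultimately show ?thesis using that by blast
qed

text \<open>By the mean value theorem the length ratio is the derivative at some point of the arc,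
  and the modulus compares it with the derivative at \<open>w\<close>. The constant is the same for
  all lifts and arcs.\<close>

lemma arc_image_length_bound:
  assumes "concave_modulus \<alpha>" "f \<in> Diff1_modulus \<alpha>"
  obtains C where "0 \<le> C"
    "\<And>F s t w. is_lift F f \<Longrightarrow> continuous_on UNIV F \<Longrightarrow> s < t \<Longrightarrow> s \<le> w \<Longrightarrow> w \<le> t \<Longrightarrow>
      F t - F s \<le> (circle_deriv f (circle_of w) + C * \<alpha> (t - s)) * (t - s)"
proof -
  have f: "f \<in> Diff1" "modulus_continuous \<alpha> (circle_deriv f)"
    using assms(2) by (auto simp: Diff1_modulus_def)
  obtain C where C: "0 \<le> C"
      "\<And>s t. \<bar>circle_deriv f (circle_of s) - circle_deriv f (circle_of t)\<bar> \<le> C * \<alpha> \<bar>s - t\<bar>"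
    using modulus_continuous_bound[OF assms(1) f(2)] by blast
  have "F t - F s \<le> (circle_deriv f (circle_of w) + C * \<alpha> (t - s)) * (t - s)"
    if F: "is_lift F f" "continuous_on UNIV F" and w: "s < t" "s \<le> w" "w \<le> t" for F s t w
  proof -
    have "(F has_real_derivative circle_deriv f (circle_of x)) (at x)" for x
      using F Diff1_has_derivative[OF f(1)] by (rule has_derivative_of_lift)
    then obtain x where x: "s < x" "x < t" "F t - F s = (t - s) * circle_deriv f (circle_of x)"
      using MVT2[OF w(1), of F "\<lambda>x. circle_deriv f (circle_of x)"] by blast
    have "circle_deriv f (circle_of x) - circle_deriv f (circle_of w) \<le> C * \<alpha> \<bar>x - w\<bar>"
      using C(2)[of x w] by linarith
    also have "\<dots> \<le> C * \<alpha> (t - s)"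
      using x w C(1)
      by (intro mult_left_mono mono_onD[OF concave_modulus_mono[OF assms(1)]]) auto
    finally show ?thesis
      using w(1) by (simp add: x(3) mult.commute mult_left_mono)
  qed
  then show ?thesis using that C(1) by blast
qed

lemma Diff1_deriv_bounds:
  assumes "h \<in> Diff1"
  obtains m M where "0 < m" "\<And>y. m \<le> circle_deriv h y" "\<And>y. circle_deriv h y \<le> M"
proof -
  have "continuous_on UNIV (circle_deriv h)"
    using assms by (simp add: Diff1_def C1_circle_map_def)
  then obtain y1 y2 where "\<And>y. circle_deriv h y1 \<le> circle_deriv h y"
      "\<And>y. circle_deriv h y \<le> circle_deriv h y2"
    using continuous_attains_inf[OF compact_UNIV_circle] continuous_attains_sup[OF compact_UNIV_circle]
    by (metis UNIV_I empty_iff)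
  then show ?thesis using that Diff1_deriv_pos[OF assms] by blast
qed

text \<open>If the image had length at least 1, the intermediate value theorem would give two points
  of an arc shorter than 1 with the same image on the circle.\<close>

lemma arc_image_short:
  assumes f: "f \<in> Diff1" and F: "is_lift F f" "continuous_on UNIV F"
    and "u \<le> v" "v < u + 1"
  shows "F v - F u < 1"
proof (rule ccontr)
  assume "\<not> F v - F u < 1"
  then obtain t where t: "u \<le> t" "t \<le> v" "F u + 1 = F t"
    using IVT'[of F u "F u + 1" v] assms(4) continuous_on_subset[OF F(2)] by auto
  have "circle_of (F t) = circle_of (F u)"
    by (simp add: circle_of_eq_iff flip: t(3))
  then have "f (circle_of t) = f (circle_of u)" using F(1) by (simp add: is_lift_def)
  then have "circle_of t = circle_of u" using f by (simp add: Diff1_def bij_is_inj inj_eq)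
  then have "t - u \<in> \<int>" by (simp add: circle_of_eq_iff)
  moreover have "\<bar>t - u\<bar> < 1" using t assms by simp
  ultimately have "t = u" using Ints_nonzero_abs_less1[of "t - u"] by simp
  then show False using t(3) by simp
qed

theorem theorem1p3:
  fixes \<alpha> :: "real \<Rightarrow> real"
    and \<rho> \<rho>bar :: "int ^ 'd \<Rightarrow> circle \<Rightarrow> circle"
    and H :: "circle \<Rightarrow> circle"
    and K :: "circle set"
    and S :: "(int ^ 'd) set"
  assumes "concave_modulus \<alpha>"
    and "finite S" and "group_closure S = UNIV"
    and "action_in (Diff1_modulus \<alpha>) \<rho>"
    and "exceptional_minimal_set \<rho> K"
    and "action_in Diff1 \<rho>bar" and "inj \<rho>bar"
    and "C1_conjugate_into_rotations \<rho>bar"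
    and "semi_conjugacy H \<rho> \<rho>bar"
    and "\<And>s x. s \<in> S \<Longrightarrow> x \<in> K \<Longrightarrow>
           circle_deriv (\<rho> s) x = circle_deriv (\<rho>bar s) (H x)"
  shows "(\<integral>\<^sup>+ t\<in>{0..1}. ennreal (inv_into {0..} \<alpha> t / t ^ (CARD('d) + 1)) \<partial>lborel) < \<infinity>"
proof -
  note \<alpha> = concave_modulus_properties[OF assms(1)]

  \<comment> \<open>The inverse modulus\<close>
  define \<beta> where "\<beta> = inv_into {0..} \<alpha>"
  have \<beta>_nonneg: "0 \<le> \<beta> s" and \<alpha>_\<beta>: "\<alpha> (\<beta> s) = s" if "0 \<le> s" for s
    using inv_into_into[of s \<alpha> "{0..}"] f_inv_into_f[of s \<alpha> "{0..}"] that \<alpha>(4)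
    by (auto simp: \<beta>_def)
  have \<beta>_pos: "0 < \<beta> s" if "0 < s" for s
    using \<beta>_nonneg[of s] \<alpha>_\<beta>[of s] \<alpha>(2) that by (cases "\<beta> s = 0") auto
  have \<beta>_mono: "mono_on {0..1} \<beta>"
  proof (rule mono_onI, rule ccontr)
    fix s t :: real assume st: "s \<in> {0..1}" "t \<in> {0..1}" "s \<le> t" and "\<not> \<beta> s \<le> \<beta> t"
    then have "\<alpha> (\<beta> t) \<le> \<alpha> (\<beta> s)"
      using \<beta>_nonneg by (intro mono_onD[OF \<alpha>(1)]) auto
    then have "s = t" using \<alpha>_\<beta> st by simp
    then show False using \<open>\<not> \<beta> s \<le> \<beta> t\<close> by simp
  qed
  have \<rho>_mod: "\<rho> g \<in> Diff1_modulus \<alpha>" and \<rho>_add: "\<rho> (g + g') = \<rho> g \<circ> \<rho> g'" for g g'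
    using assms(4) by (auto simp: action_in_def)
  have \<rho>_Diff1: "\<rho> g \<in> Diff1" for g using \<rho>_mod by (simp add: Diff1_modulus_def)
  have \<rho>_action: "action_in Diff1 \<rho>"
    using assms(4) \<rho>_Diff1 by (simp add: action_in_def)
  have \<rho>bar_Diff1: "\<rho>bar g \<in> Diff1" for g using assms(6) by (simp add: action_in_def)
  have inv_K: "invariant_set \<rho> K"
    using assms(5) by (simp add: exceptional_minimal_set_def minimal_set_def)
  have equi: "H (\<rho> g x) = \<rho>bar g (H x)" for g x
    using assms(9) by (auto simp: semi_conjugacy_def fun_eq_iff)
  obtain h r where h: "h \<in> Diff1" "\<And>g. h \<circ> \<rho>bar g \<circ> inv h = rotation (r g)"
    using assms(8) unfolding C1_conjugate_into_rotations_def by metis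
  define \<phi> where "\<phi> = circle_deriv h"
  obtain m M where m: "0 < m" "\<And>y. m \<le> \<phi> y" and M: "\<And>y. \<phi> y \<le> M"
    using Diff1_deriv_bounds[OF h(1)] unfolding \<phi>_def by metis
  have "0 < M" using m M by (meson less_le_trans)
  \<comment> \<open>Equality of derivatives on \<open>S\<close> extends to all of the lattice, where
    conjugacy to rotations makes the derivative along \<open>K\<close> a coboundary of
    \<open>\<phi>\<close>.\<close>
  have deriv_K: "circle_deriv (\<rho> g) x = \<phi> (H x) / \<phi> (\<rho>bar g (H x))" if "x \<in> K" for g x
    using derivs_agree_on_group_closure[where H = H and S = S and g = g and x = x,
        OF \<rho>_action assms(6) inv_K equi assms(10)]
      assms(3) that conjugacy_deriv_cocycle[OF h(1) \<rho>bar_Diff1 h(2)]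
    by (simp add: \<phi>_def)
  obtain u v w where uvw: "u < v" "v < u + 1" "u \<le> w" "w \<le> v" and w: "circle_of w \<in> K"
    and collapsed: "\<And>t. u \<le> t \<Longrightarrow> t \<le> v \<Longrightarrow> H (circle_of t) = H (circle_of w)"
    using ex_collapsed_arc[OF assms(5,6,7) h assms(9)] by blast

  \<comment> \<open>Lengths of the images of the collapsed arc\<close>
  have "\<forall>g. \<exists>F. is_lift F (\<rho> g) \<and> continuous_on UNIV F \<and> strict_mono F"
    using Diff1_lift[OF \<rho>_Diff1] by metis
  then obtain R where R: "\<And>g. is_lift (R g) (\<rho> g)" "\<And>g. continuous_on UNIV (R g)"
      "\<And>g. strict_mono (R g)"
    by metis
  define len where "len g = R g v - R g u" for g
  define y where "y g = \<rho>bar g (H (circle_of w))" for g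
  \<comment> \<open>The weight cancels the leading factor
    \<open>\<phi> (y g) / \<phi> (y g')\<close> by which a step changes the length; only the
    distortion term remains.\<close>
  define L where "L g = \<phi> (y g) * len g" for g
  have len_pos: "0 < len g" for g using R(3) uvw(1) by (simp add: len_def strict_monoD)
  have H_arc: "H (circle_of x) = y g" if x: "x \<in> {R g u..R g v}" for x g
  proof -
    obtain t where t: "u \<le> t" "t \<le> v" "R g t = x"
      using IVT'[of "R g" u x v] x uvw(1) continuous_on_subset[OF R(2)] by auto
    then have "circle_of x = \<rho> g (circle_of t)" using R(1) by (auto simp: is_lift_def)
    then show ?thesis using collapsed[OF t(1,2)] by (simp add: equi y_def)
  qed
  \<comment> \<open>\<open>H\<close> sends the whole arc of \<open>g\<close> to \<open>y g\<close>,
    so arcs that meet have the same \<open>y\<close>, and freeness applies.\<close>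
  have disjoint: "circle_of ` {R g u..R g v} \<inter> circle_of ` {R g' u..R g' v} = {}" if "g \<noteq> g'" for g g'
  proof (rule ccontr)
    assume "circle_of ` {R g u..R g v} \<inter> circle_of ` {R g' u..R g' v} \<noteq> {}"
    then obtain s s' where "s \<in> {R g u..R g v}" "s' \<in> {R g' u..R g' v}" "circle_of s = circle_of s'"
      by blast
    then have "y g = y g'" using H_arc by metis
    then have "g = g'"
      unfolding y_def by (rule conjugate_into_rotations_free[OF h(1) assms(7) h(2)])
    then show False using that by simp
  qed
  have sum_len: "sum len A \<le> 2" if "finite A" for A
    unfolding len_def
  proof (rule sum_lengths_le_of_disjoint_arcs[OF that])
    show "R g u \<le> R g v" for g using len_pos[of g] by (simp add: len_def)
    show "R g v - R g u \<le> 1" for g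
      using arc_image_short[OF \<rho>_Diff1 R(1,2)] uvw by (simp add: less_imp_le)
  qed (rule disjoint)

  \<comment> \<open>Change of the weighted length under a unit step\<close>
  have "\<exists>C\<ge>0. \<forall>F s t w. is_lift F (\<rho> (- axis i 1)) \<longrightarrow> continuous_on UNIV F \<longrightarrow>
      s < t \<longrightarrow> s \<le> w \<longrightarrow> w \<le> t \<longrightarrow>
      F t - F s \<le> (circle_deriv (\<rho> (- axis i 1)) (circle_of w) + C * \<alpha> (t - s)) * (t - s)" for i
    using arc_image_length_bound[OF assms(1) \<rho>_mod[of "- axis i 1"]] by metis
  then obtain C where C: "\<And>i. 0 \<le> C i" and length_bound: "\<And>i F s t w.
      is_lift F (\<rho> (- axis i 1)) \<Longrightarrow> continuous_on UNIV F \<Longrightarrow> s < t \<Longrightarrow> s \<le> w \<Longrightarrow> w \<le> t \<Longrightarrow>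
      F t - F s \<le> (circle_deriv (\<rho> (- axis i 1)) (circle_of w) + C i * \<alpha> (t - s)) * (t - s)"
    by metis
  \<comment> \<open>\<open>M\<close> bounds the weight at the new point, the sum dominates every
    \<open>C i\<close>, and \<open>1 / m\<close> comes from
    \<open>len g \<le> L g / m\<close>.\<close>
  define Q where "Q = M * sum C UNIV / m"
  have C_le: "C i \<le> sum C UNIV" for i using C by (intro member_le_sum) auto
  have Q_nonneg: "0 \<le> Q"
    using \<open>0 < M\<close> m(1) C by (simp add: Q_def sum_nonneg)
  have step: "L (g - axis i 1) \<le> L g * (1 + Q * \<alpha> (L g / m))" for g i
  proof -
    define g' where "g' = g - axis i 1"
    define F where "F = R (- axis i 1)"
    have \<rho>_g': "\<rho> g' = \<rho> (- axis i 1) \<circ> \<rho> g"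
      using \<rho>_add[of "- axis i 1" g] by (simp add: g'_def)
    have y_g': "\<rho>bar (- axis i 1) (y g) = y g'"
      using fun_cong[OF \<rho>_g', of "circle_of w"] by (simp add: y_def flip: equi)
    have "is_lift (F \<circ> R g) (\<rho> g')"
      unfolding \<rho>_g' F_def by (intro is_lift_comp R)
    moreover have "continuous_on UNIV (F \<circ> R g)"
      unfolding F_def by (intro continuous_on_compose R continuous_on_subset[OF R(2)]) simp
    \<comment> \<open>The lifts were chosen separately for each group element, so they compose only
      up to a constant, which drops out of lengths.\<close>
    ultimately obtain c where "\<And>t. R g' t = F (R g t) + c"
      using continuous_lifts_differ_by_constant[OF R(1,2)[of g']] unfolding o_def by blast
    then have len_g': "len g' = F (R g v) - F (R g u)" by (simp add: len_def)
    have Rw: "R g u \<le> R g w" "R g w \<le> R g v"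
      using R(3)[of g] uvw by (auto simp: strict_mono_less_eq)
    have "\<rho> g (circle_of w) \<in> K" using inv_K w by (auto simp: invariant_set_def)
    moreover have "circle_of (R g w) = \<rho> g (circle_of w)" using R(1) by (simp add: is_lift_def)
    ultimately have "circle_deriv (\<rho> (- axis i 1)) (circle_of (R g w)) = \<phi> (y g) / \<phi> (y g')"
      using deriv_K[of "\<rho> g (circle_of w)" "- axis i 1"] y_g' by (simp add: equi y_def)
    then have "len g' \<le> (\<phi> (y g) / \<phi> (y g') + C i * \<alpha> (len g)) * len g"
      using length_bound[OF R(1)[of "- axis i 1"] R(2) _ Rw] len_pos[of g] unfolding len_g'
      by (simp add: F_def len_def)
    moreover have \<phi>_pos: "0 < \<phi> x" for x using m by (meson less_le_trans)
    ultimately have "L g' \<le> \<phi> (y g') * ((\<phi> (y g) / \<phi> (y g') + C i * \<alpha> (len g)) * len g)"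
      unfolding L_def by (intro mult_left_mono) (auto simp: less_imp_le)
    also have "\<dots> = L g + \<phi> (y g') * C i * \<alpha> (len g) * len g"
      using \<phi>_pos[of "y g'"] by (simp add: L_def field_simps)
    also have "\<phi> (y g') * C i * \<alpha> (len g) * len g \<le> M * sum C UNIV * \<alpha> (L g / m) * (L g / m)"
    proof -
      have len_le: "len g \<le> L g / m"
        using m(1) m(2)[of "y g"] len_pos[of g] by (simp add: L_def field_simps)
      have "\<alpha> (len g) \<le> \<alpha> (L g / m)"
        using len_le len_pos[of g] by (intro mono_onD[OF \<alpha>(1)]) auto
      then show ?thesis
        using len_le len_pos[of g] \<alpha>(3)[of "len g"] \<open>0 < M\<close> C C_le M \<phi>_pos
        by (intro mult_mono mult_nonneg_nonneg) (auto intro: less_imp_le sum_nonneg order_trans)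
    qed
    also have "L g + M * sum C UNIV * \<alpha> (L g / m) * (L g / m) = L g * (1 + Q * \<alpha> (L g / m))"
      by (simp add: Q_def algebra_simps)
    finally show ?thesis by (simp add: g'_def)
  qed

  \<comment> \<open>Summation\<close>
  have L_pos: "0 < L g" for g
    unfolding L_def using len_pos m by (intro mult_pos_pos) (auto intro: less_le_trans)
  have "sum L A \<le> M * 2" if "finite A" for A
  proof -
    have "sum L A \<le> (\<Sum>g\<in>A. M * len g)"
      unfolding L_def using M len_pos by (intro sum_mono mult_right_mono) (auto simp: less_imp_le)
    also have "\<dots> = M * sum len A" by (simp add: sum_distrib_left)
    also have "\<dots> \<le> M * 2" using sum_len[OF that] \<open>0 < M\<close> by simp
    finally show ?thesis .
  qed
  then have "summable (\<lambda>k. 2 ^ (k * CARD('d)) * \<beta> (1 / 2 ^ k))"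
    using summable_of_slow_growth[OF \<alpha>(1,3) \<beta>_nonneg \<alpha>_\<beta> \<beta>_pos m(1) Q_nonneg L_pos step]
    by blast
  then show ?thesis
    using nn_integral_dyadic_finite[OF \<beta>_mono] \<beta>_nonneg[of 0] unfolding \<beta>_def by simp
qed

end
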